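(* Let $\Pi$ be a game on a finite set $I$ and let $a\in I$ be a fixed element. Assume that $G$ is a finite group of odd order and $\Phi:G\times I\to I$ is an action of $G$ on $\Pi$. Let $H=Iso_a=\Phi_a^{-1}(\{a\})$. Choose $A_0$ a game subset for $H$ and let $A=A_0\cup\Phi_a^{-1}(\Pi(a))$. Then the set $A\subset G$ is a game subset for $(G,H)$. Let $\pi:G\to G/H$ be the canonical projection. The map $\Phi_a$ is a morphism from $\Gamma[A]$ to $\Pi$ and it factors through $\pi$ to define $\theta_a:G/H\to I$ which is an embedding from $\Gamma[A/H]$ to $\Pi$. The restriction $\Pi|Ga$ of $\Pi$ to the orbit $Ga$ is a subgame of $\Pi$ (i.e. is itself a game on $Ga$) and the bijection $\theta_a:G/H\to Ga$ is an isomorphism from $\Gamma[A/H]$ to $\Pi|Ga$.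
   Context: A tournament on a finite set $I$ is a relation $\Pi\subset I\times I$ without loops such that for distinct $i,j$ exactly one of $(i,j),(j,i)$ is in $\Pi$; write $i\to j$ for $(i,j)\in\Pi$, $\Pi(i)=\{j:i\to j\}$, and $\Pi|J=\Pi\cap(J\times J)$ for $J\subset I$. A game is a tournament on a set of odd size $2n+1$ in which every vertex has $n$ outputs and $n$ inputs. A morphism from a tournament on $I$ to a tournament on $J$ is a map $\rho:I\to J$ such that whenever $\rho(i)\ne\rho(j)$, $i\to j$ if and only if $\rho(i)\to\rho(j)$; an embedding is an injective morphism and an isomorphism is a bijective morphism. An action of $G$ on $\Pi$ is a group action on $I$ for which every $i\mapsto gi$ is an automorphism of $\Pi$; $\Phi_a(g)=\Phi(g,a)=ga$, and $Ga=\Phi_a(G)$. For a finite group $G$ of odd order with identity $e$, a game subset is $A\subset G$ such that $G$ is the disjoint union $A\cup A^{-1}\cup\{e\}$ (for the trivial group, $A=\emptyset$), and $\Gamma[A]=\{(i,j)\in G\times G:i^{-1}j\in A\}$. For a subgroup $H$ of $G$, $A$ is a game subset for $(G,H)$ if it is a game subset of $G$ and $i\in A\setminus H$ implies $HiH\subset A$. In that case $G/H=\{iH:i\in G\}$ is the set of left cosets, $A/H=\{iH:iH\subset A\}$, and $\Gamma[A/H]=\{(iH,jH):i^{-1}jH\in A/H\}$, which is a game on $G/H$. *)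

theory Defs
  imports "HOL-Algebra.Group_Action" "HOL-Algebra.Left_Coset"
begin

definition tournament :: "'a set \<Rightarrow> ('a \<times> 'a) set \<Rightarrow> bool" where
  "tournament I P \<longleftrightarrow> finite I \<and> P \<subseteq> I \<times> I \<and> (\<forall>i\<in>I. (i, i) \<notin> P) \<and>
     (\<forall>i\<in>I. \<forall>j\<in>I. i \<noteq> j \<longrightarrow> ((i, j) \<in> P \<longleftrightarrow> (j, i) \<notin> P))"

definition outputs :: "('a \<times> 'a) set \<Rightarrow> 'a \<Rightarrow> 'a set" where
  "outputs P i = {j. (i, j) \<in> P}"

definition inputs :: "('a \<times> 'a) set \<Rightarrow> 'a \<Rightarrow> 'a set" where
  "inputs P i = {j. (j, i) \<in> P}"

definition game :: "'a set \<Rightarrow> ('a \<times> 'a) set \<Rightarrow> bool" where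
  "game I P \<longleftrightarrow> tournament I P \<and>
     (\<exists>n. card I = 2 * n + 1 \<and> (\<forall>i\<in>I. card (outputs P i) = n \<and> card (inputs P i) = n))"

definition subgame :: "'a set \<Rightarrow> 'a set \<Rightarrow> ('a \<times> 'a) set \<Rightarrow> bool" where
  "subgame J I P \<longleftrightarrow> J \<subseteq> I \<and> game J (Restr P J)"

text \<open>The maps are constrained on the vertex set only, and both relations are required to
  be tournaments.\<close>

definition tournament_morphism ::
  "'a set \<Rightarrow> ('a \<times> 'a) set \<Rightarrow> 'b set \<Rightarrow> ('b \<times> 'b) set \<Rightarrow> ('a \<Rightarrow> 'b) \<Rightarrow> bool" where
  "tournament_morphism I P J Q \<rho> \<longleftrightarrow> tournament I P \<and> tournament J Q \<and> \<rho> \<in> I \<rightarrow> J \<and>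
     (\<forall>i\<in>I. \<forall>j\<in>I. \<rho> i \<noteq> \<rho> j \<longrightarrow> ((i, j) \<in> P \<longleftrightarrow> (\<rho> i, \<rho> j) \<in> Q))"

definition tournament_embedding ::
  "'a set \<Rightarrow> ('a \<times> 'a) set \<Rightarrow> 'b set \<Rightarrow> ('b \<times> 'b) set \<Rightarrow> ('a \<Rightarrow> 'b) \<Rightarrow> bool" where
  "tournament_embedding I P J Q \<rho> \<longleftrightarrow> tournament_morphism I P J Q \<rho> \<and> inj_on \<rho> I"

definition tournament_iso ::
  "'a set \<Rightarrow> ('a \<times> 'a) set \<Rightarrow> 'b set \<Rightarrow> ('b \<times> 'b) set \<Rightarrow> ('a \<Rightarrow> 'b) \<Rightarrow> bool" where
  "tournament_iso I P J Q \<rho> \<longleftrightarrow> tournament_morphism I P J Q \<rho> \<and> bij_betw \<rho> I J"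

definition tournament_action ::
  "('g, 'm) monoid_scheme \<Rightarrow> 'a set \<Rightarrow> ('a \<times> 'a) set \<Rightarrow> ('g \<Rightarrow> 'a \<Rightarrow> 'a) \<Rightarrow> bool" where
  "tournament_action G I P \<phi> \<longleftrightarrow> group_action G I \<phi> \<and>
     (\<forall>g\<in>carrier G. tournament_iso I P I P (\<phi> g))"

text \<open>The next two notions are meant for finite groups \<open>G\<close> of odd order.\<close>

definition game_subset :: "('g, 'm) monoid_scheme \<Rightarrow> 'g set \<Rightarrow> bool" where
  "game_subset G A \<longleftrightarrow> A \<union> set_inv\<^bsub>G\<^esub> A \<union> {\<one>\<^bsub>G\<^esub>} = carrier G \<and>
     A \<inter> set_inv\<^bsub>G\<^esub> A = {} \<and> \<one>\<^bsub>G\<^esub> \<notin> A \<and> \<one>\<^bsub>G\<^esub> \<notin> set_inv\<^bsub>G\<^esub> A"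

definition rel_game_subset :: "('g, 'm) monoid_scheme \<Rightarrow> 'g set \<Rightarrow> 'g set \<Rightarrow> bool" where
  "rel_game_subset G H A \<longleftrightarrow> subgroup H G \<and> game_subset G A \<and>
     (\<forall>i \<in> A - H. H <#>\<^bsub>G\<^esub> (i <#\<^bsub>G\<^esub> H) \<subseteq> A)"

definition group_game :: "('g, 'm) monoid_scheme \<Rightarrow> 'g set \<Rightarrow> ('g \<times> 'g) set" where
  "group_game G A =
     {(i, j). i \<in> carrier G \<and> j \<in> carrier G \<and> inv\<^bsub>G\<^esub> i \<otimes>\<^bsub>G\<^esub> j \<in> A}"

definition coset_subset :: "('g, 'm) monoid_scheme \<Rightarrow> 'g set \<Rightarrow> 'g set \<Rightarrow> 'g set set" where
  "coset_subset G H A = {i <#\<^bsub>G\<^esub> H | i. i \<in> carrier G \<and> i <#\<^bsub>G\<^esub> H \<subseteq> A}"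

definition coset_game ::
  "('g, 'm) monoid_scheme \<Rightarrow> 'g set \<Rightarrow> 'g set \<Rightarrow> ('g set \<times> 'g set) set" where
  "coset_game G H A = {(i <#\<^bsub>G\<^esub> H, j <#\<^bsub>G\<^esub> H) | i j. i \<in> carrier G \<and> j \<in> carrier G \<and>
     (inv\<^bsub>G\<^esub> i \<otimes>\<^bsub>G\<^esub> j) <#\<^bsub>G\<^esub> H \<in> coset_subset G H A}"

end

theory Submission
  imports Defs
begin

text \<open>Outside the stabilizer \<open>H\<close> of \<open>a\<close>, an element \<open>g\<close> lies in \<open>A\<close> exactly when \<open>a \<rightarrow> g a\<close>. Invariance of
  the tournament turns \<open>i\<^sup>-\<^sup>1 j \<in> A\<close> into \<open>i a \<rightarrow> j a\<close>, which gives all statements about morphisms.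
  On an orbit the action is transitive, so all scores are equal and likewise all numbers of inputs; both
  total to the number of edges, hence they agree and the orbit is a game.\<close>

section \<open>Regular tournaments and transport of neighbours\<close>

lemma tournament_Restr:
  assumes "tournament I P" "J \<subseteq> I"
  shows "tournament J (Restr P J)"
  using assms finite_subset[OF assms(2)] unfolding tournament_def by blast

text \<open>Counting the edges by their tails and by their heads gives
  \<open>card J * m = card J * n\<close>, and \<open>card J\<close> cancels because \<open>J\<close>
  is finite and nonempty. A single vertex with its outputs and inputs then partitions
  \<open>J\<close>, which yields the odd size.\<close>

lemma game_if_regular:
  assumes T: "tournament J Q" and "J \<noteq> {}"
    and out: "\<And>i. i \<in> J \<Longrightarrow> card (outputs Q i) = m"
    and inp: "\<And>i. i \<in> J \<Longrightarrow> card (inputs Q i) = n"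
  shows "game J Q"
proof -
  have fin: "finite J" and sub: "Q \<subseteq> J \<times> J" using T by (auto simp: tournament_def)
  have foi: "finite (outputs Q i)" "finite (inputs Q i)" for i
    using sub fin by (auto simp: outputs_def inputs_def intro: finite_subset[of _ J])
  have "Q = Sigma J (outputs Q)" using sub by (auto simp: outputs_def)
  then have "card Q = (\<Sum>i\<in>J. card (outputs Q i))" using fin foi by (metis card_SigmaI)
  then have 1: "card Q = card J * m" using out by simp
  have "Q\<inverse> = Sigma J (inputs Q)" using sub by (auto simp: inputs_def)
  then have "card (Q\<inverse>) = (\<Sum>i\<in>J. card (inputs Q i))" using fin foi by (metis card_SigmaI)
  then have 2: "card Q = card J * n" using inp by simp
  have mn: "m = n" using 1 2 fin \<open>J \<noteq> {}\<close> by simp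
  obtain i where i: "i \<in> J" using \<open>J \<noteq> {}\<close> by blast
  have split: "(i, i) \<notin> Q" "\<And>j. \<lbrakk>j \<in> J; i \<noteq> j\<rbrakk> \<Longrightarrow> (i, j) \<in> Q \<longleftrightarrow> (j, i) \<notin> Q"
    using T i unfolding tournament_def by blast+
  have disj: "outputs Q i \<inter> inputs Q i = {}" "i \<notin> outputs Q i \<union> inputs Q i"
    using split sub unfolding outputs_def inputs_def by blast+
  have "J = insert i (outputs Q i \<union> inputs Q i)"
    using split sub i unfolding outputs_def inputs_def by blast
  then have "card J = card (insert i (outputs Q i \<union> inputs Q i))" by simp
  also have "\<dots> = Suc (m + n)"
    using disj foi out[OF i] inp[OF i] by (simp add: card_Un_disjoint)
  finally have "card J = 2 * n + 1" using mn by simp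
  then show ?thesis using T out inp mn unfolding game_def by blast
qed

text \<open>Transports neighbour sets along an automorphism. Surjectivity of \<open>f\<close>
  supplies the preimage of each neighbour of \<open>f i\<close>, and \<open>inv\<close> shows that
  this preimage is a neighbour of \<open>i\<close>.\<close>

lemma neighbours_image:
  assumes bij: "bij_betw f J J"
    and inv: "\<And>i j. \<lbrakk>i \<in> J; j \<in> J\<rbrakk> \<Longrightarrow> (f i, f j) \<in> Q \<longleftrightarrow> (i, j) \<in> Q"
    and Q: "Q \<subseteq> J \<times> J" and i: "i \<in> J"
  shows "outputs Q (f i) = f ` outputs Q i" "inputs Q (f i) = f ` inputs Q i"
proof -
  have img: "f ` J = J" using bij by (simp add: bij_betw_def)
  show "outputs Q (f i) = f ` outputs Q i"
  proof (intro equalityI subsetI)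
    fix y assume y: "y \<in> outputs Q (f i)"
    then have "y \<in> f ` J" using Q img by (auto simp: outputs_def)
    then show "y \<in> f ` outputs Q i" using y inv i by (auto simp: outputs_def)
  qed (use Q inv i in \<open>auto simp: outputs_def\<close>)
  show "inputs Q (f i) = f ` inputs Q i"
  proof (intro equalityI subsetI)
    fix y assume y: "y \<in> inputs Q (f i)"
    then have "y \<in> f ` J" using Q img by (auto simp: inputs_def)
    then show "y \<in> f ` inputs Q i" using y inv i by (auto simp: inputs_def)
  qed (use Q inv i in \<open>auto simp: inputs_def\<close>)
qed

section \<open>Game subsets of a group and their tournaments\<close>

text \<open>Turns the partition of the group into a choice of exactly one element from each pair
  \<open>g\<close>, \<open>inv g\<close> with \<open>g\<close> not the identity. This elementwise
  form is the one checked and applied later.\<close>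

lemma (in group) game_subset_iff:
  "game_subset G A \<longleftrightarrow>
    A \<subseteq> carrier G \<and> \<one> \<notin> A \<and> (\<forall>g \<in> carrier G - {\<one>}. g \<in> A \<longleftrightarrow> inv g \<notin> A)"
    (is "?L \<longleftrightarrow> ?R")
proof -
  have mem: "g \<in> set_inv A \<longleftrightarrow> inv g \<in> A" if "A \<subseteq> carrier G" "g \<in> carrier G" for g
  proof
    assume "g \<in> set_inv A"
    then obtain h where "h \<in> A" "g = inv h" by (auto simp: SET_INV_def)
    then show "inv g \<in> A" using that by auto
  next
    assume "inv g \<in> A"
    then have "inv (inv g) \<in> set_inv A" unfolding SET_INV_def by blast
    then show "g \<in> set_inv A" using that by simp
  qed
  have sub: "set_inv A \<subseteq> carrier G" if "A \<subseteq> carrier G"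
    using that unfolding SET_INV_def by auto
  show ?thesis
  proof
    assume L: ?L
    then have "A \<subseteq> carrier G" by (auto simp: game_subset_def)
    with L mem show ?R unfolding game_subset_def by blast
  next
    assume R: ?R
    then have A: "A \<subseteq> carrier G" by blast
    show ?L unfolding game_subset_def
    proof (intro conjI)
      show "A \<union> set_inv A \<union> {\<one>} = carrier G" using R A mem[OF A] sub[OF A] by blast
      show "A \<inter> set_inv A = {}" using R A mem[OF A] by blast
      show "\<one> \<notin> A" using R by blast
      show "\<one> \<notin> set_inv A" using R mem[OF A one_closed] by simp
    qed
  qed
qed

text \<open>The pairs \<open>(i, j)\<close> and \<open>(j, i)\<close> are tested on the mutually
  inverse elements \<open>inv i \<otimes> j\<close> and \<open>inv j \<otimes> i\<close>, of which a
  game subset contains exactly one when \<open>i\<close> and \<open>j\<close> differ.\<close>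

lemma (in group) tournament_group_game:
  assumes "finite (carrier G)" "game_subset G A"
  shows "tournament (carrier G) (group_game G A)"
  unfolding tournament_def
proof (intro conjI ballI impI)
  show "finite (carrier G)" by fact
  show "group_game G A \<subseteq> carrier G \<times> carrier G" by (auto simp: group_game_def)
next
  fix i assume "i \<in> carrier G"
  then show "(i, i) \<notin> group_game G A"
    using assms by (simp add: group_game_def game_subset_iff)
next
  fix i j assume ij: "i \<in> carrier G" "j \<in> carrier G" "i \<noteq> j"
  then have "inv i \<otimes> j \<noteq> \<one>" by (metis inv_closed inv_equality inv_inv)
  then have "inv i \<otimes> j \<in> carrier G - {\<one>}" using ij by simp
  then have "inv i \<otimes> j \<in> A \<longleftrightarrow> inv (inv i \<otimes> j) \<notin> A"
    using assms(2) unfolding game_subset_iff by blast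
  moreover have "inv (inv i \<otimes> j) = inv j \<otimes> i" using ij by (simp add: inv_mult_group)
  ultimately have "inv i \<otimes> j \<in> A \<longleftrightarrow> inv j \<otimes> i \<notin> A" by (simp only:)
  then show "((i, j) \<in> group_game G A) = ((j, i) \<notin> group_game G A)"
    using ij by (simp add: group_game_def)
qed

section \<open>Stabilizer, cosets and orbit of a point\<close>

text \<open>Invariance is recorded for all pairs of vertices, equal ones included, so that later
  steps can rewrite with it without comparing images first.\<close>

locale pointed_tournament_action = group_action G I \<phi>
  for G (structure) and I :: "'a set" and \<phi> +
  fixes P :: "('a \<times> 'a) set" and a :: 'a
  assumes tournament: "tournament I P"
    and base: "a \<in> I"
    and invariant: "\<lbrakk>g \<in> carrier G; i \<in> I; j \<in> I\<rbrakk> \<Longrightarrow> (\<phi> g i, \<phi> g j) \<in> P \<longleftrightarrow> (i, j) \<in> P"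
begin

sublocale group G
  using group_hom group_hom.axioms(1) by blast

abbreviation "H \<equiv> stabilizer G \<phi> a"

lemma loop_free: "i \<in> I \<Longrightarrow> (i, i) \<notin> P"
  and antisymmetric: "\<lbrakk>i \<in> I; j \<in> I; i \<noteq> j\<rbrakk> \<Longrightarrow> (i, j) \<in> P \<longleftrightarrow> (j, i) \<notin> P"
  using tournament unfolding tournament_def by blast+

lemma action_closed: "\<lbrakk>g \<in> carrier G; i \<in> I\<rbrakk> \<Longrightarrow> \<phi> g i \<in> I"
  using element_image by blast

lemma orbit_subset: "orbit G \<phi> a \<subseteq> I"
  using action_closed base by (auto simp: orbit_def)

lemma action_inv_mult:
  assumes "i \<in> carrier G" "j \<in> carrier G"
  shows "\<phi> i (\<phi> (inv i \<otimes> j) a) = \<phi> j a"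
  using assms base by (simp add: composition_rule[symmetric] m_assoc[symmetric])

text \<open>The automorphism \<open>\<phi> i\<close> carries the pair on the left to the pair on the
  right. This links the test on \<open>inv i \<otimes> j\<close> that defines the games on
  \<open>G\<close> and on its cosets with edges of \<open>P\<close>.\<close>

lemma edge_inv_mult:
  assumes "i \<in> carrier G" "j \<in> carrier G"
  shows "(a, \<phi> (inv i \<otimes> j) a) \<in> P \<longleftrightarrow> (\<phi> i a, \<phi> j a) \<in> P"
  using invariant[of i a "\<phi> (inv i \<otimes> j) a"] assms base
  by (simp add: action_inv_mult action_closed)

lemma inv_mult_in_stabilizer_iff:
  assumes "i \<in> carrier G" "j \<in> carrier G"
  shows "inv i \<otimes> j \<in> H \<longleftrightarrow> \<phi> i a = \<phi> j a"
proof
  assume "inv i \<otimes> j \<in> H"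
  then show "\<phi> i a = \<phi> j a" using action_inv_mult[OF assms] by (simp add: stabilizer_def)
next
  assume "\<phi> i a = \<phi> j a"
  then have "\<phi> i (\<phi> (inv i \<otimes> j) a) = \<phi> i a" using action_inv_mult[OF assms] by simp
  \<comment> \<open>The injective map \<open>\<phi> i\<close> is cancelled on both sides.\<close>
  then have "\<phi> (inv i \<otimes> j) a = a"
    by (rule inj_onD[OF inj_prop[OF assms(1)]]) (use assms base action_closed in auto)
  then show "inv i \<otimes> j \<in> H" using assms by (simp add: stabilizer_def)
qed

text \<open>The orbit-stabilizer correspondence: one direction makes the map on cosets well defined,
  the other makes it injective.\<close>

lemma lcoset_eq_iff:
  assumes "i \<in> carrier G" "j \<in> carrier G"
  shows "i <# H = j <# H \<longleftrightarrow> \<phi> i a = \<phi> j a"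
proof -
  note sub = stabilizer_subgroup[OF base]
  have "i <# H = j <# H \<longleftrightarrow> j \<in> i <# H"
    using lcos_self[OF assms(2) sub] l_repr_independence[OF _ assms(1) sub] by blast
  also have "\<dots> \<longleftrightarrow> inv i \<otimes> j \<in> H"
    using subgroup.lcos_module_imp[OF sub is_group assms(1)]
      subgroup.lcos_module_rev[OF sub is_group assms] by blast
  finally show ?thesis using inv_mult_in_stabilizer_iff[OF assms] by simp
qed

text \<open>Each \<open>\<phi> g\<close> restricts to an automorphism of the tournament on the
  orbit, so \<open>\<phi> g a\<close> has as many outputs and as many inputs there as
  \<open>a\<close>. Every vertex of the orbit has this form.\<close>

lemma orbit_game:
  "game (orbit G \<phi> a) (Restr P (orbit G \<phi> a))"
proof -
  let ?J = "orbit G \<phi> a"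
  let ?Q = "Restr P ?J"
  have aJ: "a \<in> ?J" using orbit_refl base by simp
  have card_eq: "card (outputs ?Q (\<phi> g a)) = card (outputs ?Q a)"
    "card (inputs ?Q (\<phi> g a)) = card (inputs ?Q a)" if g: "g \<in> carrier G" for g
  proof -
    have inj: "inj_on (\<phi> g) ?J" using inj_prop[OF g] orbit_subset by (rule inj_on_subset)
    have closed: "\<phi> g j \<in> ?J" if "j \<in> ?J" for j
    proof -
      from that obtain k where "k \<in> carrier G" "j = \<phi> k a" by (auto simp: orbit_def)
      then have "\<phi> g j = \<phi> (g \<otimes> k) a" "g \<otimes> k \<in> carrier G"
        using g base by (simp_all add: composition_rule)
      then show ?thesis unfolding orbit_def by blast
    qed
    have onto: "j \<in> \<phi> g ` ?J" if "j \<in> ?J" for j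
    proof -
      from that obtain k where k: "k \<in> carrier G" "j = \<phi> k a" by (auto simp: orbit_def)
      \<comment> \<open>The preimage of \<open>\<phi> k a\<close> under \<open>\<phi> g\<close> is
        again a translate of \<open>a\<close>, hence stays in the orbit.\<close>
      then have "j = \<phi> g (\<phi> (inv g \<otimes> k) a)" using g by (simp add: action_inv_mult)
      moreover have "\<phi> (inv g \<otimes> k) a \<in> ?J" using g k unfolding orbit_def by blast
      ultimately show ?thesis by blast
    qed
    have bij: "bij_betw (\<phi> g) ?J ?J"
      using inj closed onto unfolding bij_betw_def by blast
    have inv: "(\<phi> g i, \<phi> g j) \<in> ?Q \<longleftrightarrow> (i, j) \<in> ?Q" if "i \<in> ?J" "j \<in> ?J" for i j
      using that orbit_subset invariant[OF g] closed by blast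
    have Q: "?Q \<subseteq> ?J \<times> ?J" by blast
    have img: "outputs ?Q (\<phi> g a) = \<phi> g ` outputs ?Q a" "inputs ?Q (\<phi> g a) = \<phi> g ` inputs ?Q a"
      by (rule neighbours_image[OF bij _ Q aJ]; erule (1) inv)+
    have "inj_on (\<phi> g) (outputs ?Q a)" "inj_on (\<phi> g) (inputs ?Q a)"
      by (rule inj_on_subset[OF inj], force simp: outputs_def inputs_def)+
    then show "card (outputs ?Q (\<phi> g a)) = card (outputs ?Q a)"
      "card (inputs ?Q (\<phi> g a)) = card (inputs ?Q a)"
      unfolding img by (simp_all add: card_image)
  qed
  show ?thesis
  proof (rule game_if_regular)
    show "tournament ?J ?Q" using tournament_Restr tournament orbit_subset by blast
    show "?J \<noteq> {}" using aJ by blast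
    show "card (outputs ?Q i) = card (outputs ?Q a)" if "i \<in> ?J" for i
      using that card_eq by (auto simp: orbit_def)
    show "card (inputs ?Q i) = card (inputs ?Q a)" if "i \<in> ?J" for i
      using that card_eq by (auto simp: orbit_def)
  qed
qed

text \<open>The value at a coset is computed from a chosen representative and is independent of the
  choice by \<open>lcoset_eq_iff\<close>. Uniqueness refers to extensional functions, which are
  determined by their values on the cosets.\<close>

lemma orbit_map_unique:
  "\<exists>!\<theta>. \<theta> \<in> (lcosets H) \<rightarrow>\<^sub>E I \<and> (\<forall>g\<in>carrier G. \<theta> (g <# H) = \<phi> g a)"
proof (rule ex_ex1I)
  define \<theta> where
    "\<theta> = (\<lambda>X \<in> lcosets H. \<phi> (SOME g. g \<in> carrier G \<and> g <# H = X) a)"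
  have "\<theta> (g <# H) = \<phi> g a" if g: "g \<in> carrier G" for g
  proof -
    let ?k = "SOME k. k \<in> carrier G \<and> k <# H = g <# H"
    have "?k \<in> carrier G \<and> ?k <# H = g <# H"
      by (rule someI[of _ g]) (use g in simp)
    then have "\<phi> ?k a = \<phi> g a" using lcoset_eq_iff g by blast
    moreover have "g <# H \<in> lcosets H" using g by (auto simp: LCOSETS_def)
    ultimately show ?thesis by (simp add: \<theta>_def)
  qed
  moreover from this have "\<theta> \<in> (lcosets H) \<rightarrow> I"
    using action_closed base by (auto simp: LCOSETS_def)
  then have "\<theta> \<in> (lcosets H) \<rightarrow>\<^sub>E I" by (simp add: PiE_def \<theta>_def)
  ultimately show
    "\<exists>\<theta>. \<theta> \<in> (lcosets H) \<rightarrow>\<^sub>E I \<and> (\<forall>g\<in>carrier G. \<theta> (g <# H) = \<phi> g a)"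
    by blast
next
  fix \<theta> \<theta>'
  assume "\<theta> \<in> (lcosets H) \<rightarrow>\<^sub>E I \<and> (\<forall>g\<in>carrier G. \<theta> (g <# H) = \<phi> g a)"
    and "\<theta>' \<in> (lcosets H) \<rightarrow>\<^sub>E I \<and> (\<forall>g\<in>carrier G. \<theta>' (g <# H) = \<phi> g a)"
  then show "\<theta> = \<theta>'" by (intro PiE_ext[of \<theta> "lcosets H" "\<lambda>_. I"]) (auto simp: LCOSETS_def)
qed

section \<open>The game subset built from the stabilizer and the outputs of the base point\<close>

context
  fixes A\<^sub>0 A :: "'b set"
  assumes stabilizer_game: "game_subset (G\<lparr>carrier := H\<rparr>) A\<^sub>0"
    and A_eq: "A = A\<^sub>0 \<union> {g \<in> carrier G. \<phi> g a \<in> outputs P a}"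
begin

text \<open>An element of \<open>H\<close> fixes \<open>a\<close>, and \<open>P\<close> has no loop
  at \<open>a\<close>, so the second set in the union contributes nothing on
  \<open>H\<close>.\<close>

lemma A_in_stabilizer: "g \<in> H \<Longrightarrow> g \<in> A \<longleftrightarrow> g \<in> A\<^sub>0"
  using loop_free base by (auto simp: A_eq outputs_def stabilizer_def)

lemma stabilizer_game_subset:
  "A\<^sub>0 \<subseteq> H" "\<one> \<notin> A\<^sub>0" "\<And>g. \<lbrakk>g \<in> H; g \<noteq> \<one>\<rbrakk> \<Longrightarrow> g \<in> A\<^sub>0 \<longleftrightarrow> inv g \<notin> A\<^sub>0"
proof -
  note sub = stabilizer_subgroup[OF base]
  interpret S: group "G\<lparr>carrier := H\<rparr>" by (rule subgroup.subgroup_is_group[OF sub is_group])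
  show "A\<^sub>0 \<subseteq> H" "\<one> \<notin> A\<^sub>0" "\<And>g. \<lbrakk>g \<in> H; g \<noteq> \<one>\<rbrakk> \<Longrightarrow> g \<in> A\<^sub>0 \<longleftrightarrow> inv g \<notin> A\<^sub>0"
    \<comment> \<open>Identity and inverses of the subgroup agree with those of
      \<open>G\<close>.\<close>
    using stabilizer_game sub by (simp_all add: S.game_subset_iff)
qed

lemma A_off_stabilizer: "\<lbrakk>g \<in> carrier G; g \<notin> H\<rbrakk> \<Longrightarrow> g \<in> A \<longleftrightarrow> (a, \<phi> g a) \<in> P"
  using stabilizer_game_subset(1) by (auto simp: A_eq outputs_def)

text \<open>On \<open>H\<close> the choice between \<open>g\<close> and \<open>inv g\<close> is made
  by \<open>A\<^sub>0\<close>. Off \<open>H\<close> it is made by the direction of the edge between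
  the distinct points \<open>a\<close> and \<open>\<phi> g a\<close>.\<close>

lemma game_subset_A: "game_subset G A"
  unfolding game_subset_iff
proof (intro conjI ballI)
  note sub = stabilizer_subgroup[OF base]
  show "A \<subseteq> carrier G"
    using stabilizer_game_subset(1) stabilizer_subset by (auto simp: A_eq)
  show "\<one> \<notin> A"
    using A_in_stabilizer stabilizer_game_subset(2) subgroup.one_closed[OF sub] by blast
  fix g assume "g \<in> carrier G - {\<one>}"
  then have g: "g \<in> carrier G" "g \<noteq> \<one>" by auto
  show "g \<in> A \<longleftrightarrow> inv g \<notin> A"
  proof (cases "g \<in> H")
    case True
    then show ?thesis
      using A_in_stabilizer stabilizer_game_subset(3) g subgroup.m_inv_closed[OF sub] by blast
  next
    case False
    then have "inv g \<notin> H" using subgroup.m_inv_closed[OF sub, of "inv g"] g by auto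
    \<comment> \<open>This is \<open>edge_inv_mult\<close> with second argument
      \<open>\<one>\<close>; the flipped \<open>id_eq_one\<close> evaluates
      \<open>\<phi> \<one> a\<close> to \<open>a\<close>.\<close>
    then have "inv g \<in> A \<longleftrightarrow> (\<phi> g a, a) \<in> P"
      using edge_inv_mult[of g \<one>] g A_off_stabilizer[of "inv g"] base
      by (simp flip: id_eq_one)
    moreover have "\<phi> g a \<noteq> a" using False g by (simp add: stabilizer_def)
    ultimately show ?thesis
      using A_off_stabilizer[OF g(1) False]
        antisymmetric[OF base action_closed[OF g(1) base] not_sym] by blast
  qed
qed

text \<open>For \<open>x = h \<otimes> (i \<otimes> k)\<close> the factor \<open>k\<close> fixes
  \<open>a\<close>, so \<open>x\<close> sends \<open>a\<close> to
  \<open>\<phi> h (\<phi> i a)\<close>. Since \<open>h\<close> fixes \<open>a\<close> too, it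
  carries the edge from \<open>a\<close> to \<open>\<phi> i a\<close> to an edge from
  \<open>a\<close> to \<open>\<phi> x a\<close>.\<close>

lemma rel_game_subset_A: "rel_game_subset G H A"
  unfolding rel_game_subset_def
proof (intro conjI ballI subsetI)
  note sub = stabilizer_subgroup[OF base]
  show "subgroup H G" by (rule sub)
  show "game_subset G A" by (rule game_subset_A)
  fix i x assume i: "i \<in> A - H" and "x \<in> H <#> (i <# H)"
  then obtain h k where hk: "h \<in> H" "k \<in> H" and x: "x = h \<otimes> (i \<otimes> k)"
    by (auto simp: set_mult_def l_coset_def)
  have car: "i \<in> carrier G" "h \<in> carrier G" "k \<in> carrier G"
    using i hk game_subset_A stabilizer_subset by (auto simp: game_subset_iff)
  have stab: "\<phi> h a = a" "\<phi> k a = a" using hk by (auto simp: stabilizer_def)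
  have "\<phi> x a = \<phi> h (\<phi> i a)" using car base stab x by (simp add: composition_rule action_closed)
  moreover have "(a, \<phi> i a) \<in> P" using A_off_stabilizer i car by blast
  ultimately have "(a, \<phi> x a) \<in> P"
    using invariant[of h a "\<phi> i a"] stab car base action_closed by simp
  then show "x \<in> A" using car x by (auto simp: A_eq outputs_def)
qed

section \<open>The games on the group and on its cosets, and their maps to the tournament\<close>

text \<open>Distinct images put \<open>inv i \<otimes> j\<close> outside \<open>H\<close>, where
  membership in \<open>A\<close> is decided by an edge at \<open>a\<close>.\<close>

lemma group_game_edge_iff:
  assumes "i \<in> carrier G" "j \<in> carrier G" "\<phi> i a \<noteq> \<phi> j a"
  shows "(i, j) \<in> group_game G A \<longleftrightarrow> (\<phi> i a, \<phi> j a) \<in> P"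
  using assms A_off_stabilizer[of "inv i \<otimes> j"]
  by (simp add: group_game_def inv_mult_in_stabilizer_iff edge_inv_mult)

lemma orbit_map_morphism:
  assumes "finite (carrier G)"
  shows "tournament_morphism (carrier G) (group_game G A) I P (\<lambda>g. \<phi> g a)"
  using tournament_group_game[OF assms game_subset_A] tournament group_game_edge_iff
    action_closed base
  unfolding tournament_morphism_def by blast

text \<open>All elements of \<open>g <# H\<close> send \<open>a\<close> to the same point, so one
  edge decides whether the coset lies in \<open>A\<close>. The coset \<open>H\<close> itself is
  excluded because it contains \<open>\<one>\<close>, which is not in \<open>A\<close>.\<close>

lemma lcoset_in_coset_subset_iff:
  assumes g: "g \<in> carrier G"
  shows "g <# H \<in> coset_subset G H A \<longleftrightarrow> (a, \<phi> g a) \<in> P"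
proof -
  note sub = stabilizer_subgroup[OF base]
  have "g <# H \<in> coset_subset G H A \<longleftrightarrow> g <# H \<subseteq> A" using g by (auto simp: coset_subset_def)
  also have "\<dots> \<longleftrightarrow> (a, \<phi> g a) \<in> P"
  proof
    assume subset: "g <# H \<subseteq> A"
    have "g \<notin> H"
    proof
      assume "g \<in> H"
      then have "g <# H = H" using sub g by (simp add: coset_join3)
      then show False
        using subset game_subset_A subgroup.one_closed[OF sub] by (auto simp: game_subset_iff)
    qed
    then show "(a, \<phi> g a) \<in> P" using subset lcos_self[OF g sub] A_off_stabilizer[OF g] by blast
  next
    assume "(a, \<phi> g a) \<in> P"
    then show "g <# H \<subseteq> A"
      using g base by (auto simp: l_coset_def stabilizer_def A_eq outputs_def composition_rule)
  qed
  finally show ?thesis .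
qed

lemma coset_game_eq:
  "coset_game G H A =
    {(i <# H, j <# H) | i j. i \<in> carrier G \<and> j \<in> carrier G \<and> (\<phi> i a, \<phi> j a) \<in> P}"
proof -
  have "(inv i \<otimes> j) <# H \<in> coset_subset G H A \<longleftrightarrow> (\<phi> i a, \<phi> j a) \<in> P"
    if "i \<in> carrier G" "j \<in> carrier G" for i j
    using that by (simp add: lcoset_in_coset_subset_iff edge_inv_mult)
  then show ?thesis unfolding coset_game_def by blast
qed

text \<open>The existential over representatives in \<open>coset_game_eq\<close> disappears because
  the image of \<open>a\<close> depends only on the coset.\<close>

lemma coset_game_edge_iff:
  assumes "i \<in> carrier G" "j \<in> carrier G"
  shows "(i <# H, j <# H) \<in> coset_game G H A \<longleftrightarrow> (\<phi> i a, \<phi> j a) \<in> P"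
  using assms lcoset_eq_iff unfolding coset_game_eq by auto

text \<open>The relation is the pullback of \<open>P\<close> along a map that separates cosets, so
  both tournament conditions are inherited from \<open>P\<close>.\<close>

lemma tournament_coset_game:
  assumes "finite (carrier G)"
  shows "tournament (lcosets H) (coset_game G H A)"
proof -
  have "finite (lcosets H)" using assms by (simp add: LCOSETS_def)
  moreover have "coset_game G H A \<subseteq> (lcosets H) \<times> (lcosets H)"
    by (auto simp: coset_game_eq LCOSETS_def)
  moreover have "(X, X) \<notin> coset_game G H A" if "X \<in> lcosets H" for X
    using that by (auto simp: LCOSETS_def coset_game_edge_iff loop_free action_closed base)
  moreover have "(X, Y) \<in> coset_game G H A \<longleftrightarrow> (Y, X) \<notin> coset_game G H A"
    if "X \<in> lcosets H" "Y \<in> lcosets H" "X \<noteq> Y" for X Y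
  proof -
    from that obtain i j where ij: "i \<in> carrier G" "j \<in> carrier G" "X = i <# H" "Y = j <# H"
      by (auto simp: LCOSETS_def)
    then have "\<phi> i a \<noteq> \<phi> j a" using that(3) lcoset_eq_iff by simp
    then show ?thesis
      using antisymmetric[OF action_closed action_closed, of i a j a] ij base
        coset_game_edge_iff[of i j] coset_game_edge_iff[of j i] by blast
  qed
  ultimately show ?thesis unfolding tournament_def by blast
qed

text \<open>Both claims rest on the same three facts: \<open>\<theta>\<close> is injective, its
  image is the orbit, and it preserves and reflects edges. They differ only in whether the target is
  all of \<open>I\<close> or the orbit.\<close>

lemma coset_map:
  assumes fin: "finite (carrier G)"
    and \<theta>: "\<And>g. g \<in> carrier G \<Longrightarrow> \<theta> (g <# H) = \<phi> g a"
  shows "tournament_embedding (lcosets H) (coset_game G H A) I P \<theta>"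
    and "tournament_iso (lcosets H) (coset_game G H A)
      (orbit G \<phi> a) (Restr P (orbit G \<phi> a)) \<theta>"
proof -
  have inj: "inj_on \<theta> (lcosets H)"
    using \<theta> lcoset_eq_iff by (auto simp: inj_on_def LCOSETS_def)
  have img: "\<theta> ` (lcosets H) = orbit G \<phi> a"
    using \<theta> by (force simp: LCOSETS_def orbit_def image_iff)
  have edge: "(X, Y) \<in> coset_game G H A \<longleftrightarrow> (\<theta> X, \<theta> Y) \<in> P"
    if "X \<in> lcosets H" "Y \<in> lcosets H" for X Y
    using that \<theta> coset_game_edge_iff by (auto simp: LCOSETS_def)
  note T = tournament_coset_game[OF fin]
  show "tournament_embedding (lcosets H) (coset_game G H A) I P \<theta>"
    using inj img edge orbit_subset T tournament
    unfolding tournament_embedding_def tournament_morphism_def by blast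
  show "tournament_iso (lcosets H) (coset_game G H A)
      (orbit G \<phi> a) (Restr P (orbit G \<phi> a)) \<theta>"
    using inj img edge T tournament_Restr[OF tournament orbit_subset]
    unfolding tournament_iso_def tournament_morphism_def bij_betw_def by blast
qed

end

end

section \<open>From the given action to the conclusion\<close>

text \<open>A morphism controls only pairs with distinct images. Injectivity of
  \<open>\<phi> g\<close> covers all distinct \<open>i\<close> and \<open>j\<close>, and for equal
  ones both sides are loops and hence false.\<close>

lemma pointed_tournament_actionI:
  assumes "tournament I P" "a \<in> I" "tournament_action G I P \<phi>"
  shows "pointed_tournament_action G I \<phi> P a"
proof -
  interpret group_action G I \<phi> using assms by (simp add: tournament_action_def)
  have "(\<phi> g i, \<phi> g j) \<in> P \<longleftrightarrow> (i, j) \<in> P" if "g \<in> carrier G" "i \<in> I" "j \<in> I" for g i j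
  proof (cases "i = j")
    case True
    then show ?thesis using that assms(1) element_image unfolding tournament_def by blast
  next
    case False
    then have "\<phi> g i \<noteq> \<phi> g j" using inj_prop that by (meson inj_on_eq_iff)
    then show ?thesis using that assms(3)
      unfolding tournament_action_def tournament_iso_def tournament_morphism_def by blast
  qed
  then show ?thesis using assms by unfold_locales
qed

theorem theorem9p9:
  fixes G :: "('g, 'm) monoid_scheme" and I :: "'a set" and P :: "('a \<times> 'a) set"
    and \<phi> :: "'g \<Rightarrow> 'a \<Rightarrow> 'a" and a :: 'a and H A\<^sub>0 A :: "'g set"
  assumes "game I P" and "a \<in> I"
    and "group G" and "finite (carrier G)" and "odd (order G)"
    and "tournament_action G I P \<phi>"
    and "H = stabilizer G \<phi> a"
    and "game_subset (G\<lparr>carrier := H\<rparr>) A\<^sub>0"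
    and "A = A\<^sub>0 \<union> {g \<in> carrier G. \<phi> g a \<in> outputs P a}"
  shows "rel_game_subset G H A
    \<and> tournament_morphism (carrier G) (group_game G A) I P (\<lambda>g. \<phi> g a)
    \<and> (\<exists>!\<theta>. \<theta> \<in> (lcosets\<^bsub>G\<^esub> H) \<rightarrow>\<^sub>E I \<and> (\<forall>g\<in>carrier G. \<theta> (g <#\<^bsub>G\<^esub> H) = \<phi> g a))
    \<and> subgame (orbit G \<phi> a) I P
    \<and> (\<forall>\<theta>. \<theta> \<in> (lcosets\<^bsub>G\<^esub> H) \<rightarrow>\<^sub>E I \<and> (\<forall>g\<in>carrier G. \<theta> (g <#\<^bsub>G\<^esub> H) = \<phi> g a) \<longrightarrow>
          tournament_embedding (lcosets\<^bsub>G\<^esub> H) (coset_game G H A) I P \<theta>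
        \<and> tournament_iso (lcosets\<^bsub>G\<^esub> H) (coset_game G H A)
            (orbit G \<phi> a) (Restr P (orbit G \<phi> a)) \<theta>)"
proof -
  have "tournament I P" using assms(1) by (simp add: game_def)
  then interpret pointed_tournament_action G I \<phi> P a
    using assms(2,6) by (rule pointed_tournament_actionI)
  \<comment> \<open>These are the two assumptions carried by the facts exported from the context,
    with \<open>H\<close> replaced by the stabilizer.\<close>
  note A = assms(8,9)[unfolded assms(7)]
  show ?thesis
    unfolding assms(7) subgame_def
    using rel_game_subset_A[OF A] orbit_map_morphism[OF A assms(4)] orbit_map_unique
      orbit_subset orbit_game coset_map[OF A assms(4)]
    by blast
qed

end
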